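(* For $n\geq 1$ define $$e_n(x,y)=\begin{cases}(-1)^{k-1}y(2x-y^2)^{k-1}, & n=2k-1,\\ (-1)^{k-1}(x-y^2)(2x-y^2)^{k-1}, & n=2k.\end{cases}$$ Then for every $n\geq 1$ the André polynomial $E_{n+1}(x,y)$ equals the lower Hessenberg determinant of order $n$ $$E_{n+1}(x,y)=\det(m_{i,j})_{1\leq i,j\leq n},$$ where $m_{i,1}=x\,e_i(x,y)$ for $1\leq i\leq n$, $m_{i,j}=\binom{i}{j-1}e_{i-j+1}(x,y)$ for $2\leq j\leq i\leq n$, $m_{i,i+1}=-1$ for $1\leq i\leq n-1$, and $m_{i,j}=0$ for $j>i+1$.
   Context: An increasing tree on $[n]$ is a rooted (unordered) tree with vertex set $\{0,1,\ldots,n\}$ whose labels increase along any path from the root $0$. The degree of a vertex is the number of its children. A 0-1-2 increasing tree is an increasing tree in which every vertex has degree at most two. For $n\geq 1$ let $\mathcal{E}_n$ be the set of 0-1-2 increasing trees on $[n-1]$ (vertex set $\{0,\ldots,n-1\}$). The André polynomials are $E_n(x,y)=\sum_{T\in\mathcal{E}_n}x^{\ell(T)}y^{u(T)}$, where $\ell(T)$ is the number of leaves (degree-0 vertices) of $T$ and $u(T)$ the number of vertices of degree $1$. E.g. $E_1=x$, $E_2=xy$, $E_3=xy^2+x^2$, $E_4=xy^3+4x^2y$. *)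

theory Defs
  imports "Jordan_Normal_Form.Determinant"
begin

text \<open>
  A rooted unordered labelled tree is given by its vertex set \<open>V\<close>, its root \<open>r\<close> and the set \<open>A\<close>
  of its (parent, child) pairs.
\<close>

definition rooted_tree :: "'v set \<Rightarrow> 'v \<Rightarrow> ('v \<times> 'v) set \<Rightarrow> bool" where
  "rooted_tree V r A \<longleftrightarrow>
     A \<subseteq> V \<times> V \<and> r \<in> V \<and>
     (\<forall>u. (u, r) \<notin> A) \<and>
     (\<forall>v \<in> V - {r}. \<exists>!u. (u, v) \<in> A) \<and>
     (\<forall>v \<in> V. (r, v) \<in> A\<^sup>*)"

text \<open>
  Every arc of a rooted tree lies on a path from the root, so labels increase along all such
  paths iff they increase along every arc.
\<close>

definition increasing_trees :: "nat \<Rightarrow> (nat \<times> nat) set set" where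
  "increasing_trees n = {A. rooted_tree {0..n} 0 A \<and> (\<forall>(u, v) \<in> A. u < v)}"

definition degree_in :: "('v \<times> 'v) set \<Rightarrow> 'v \<Rightarrow> nat" where
  "degree_in A v = card {w. (v, w) \<in> A}"

definition trees012 :: "nat \<Rightarrow> (nat \<times> nat) set set" where
  "trees012 n = {A \<in> increasing_trees n. \<forall>v \<in> {0..n}. degree_in A v \<le> 2}"

definition num_of_degree :: "nat \<Rightarrow> nat \<Rightarrow> (nat \<times> nat) set \<Rightarrow> nat" where
  "num_of_degree d n A = card {v \<in> {0..n}. degree_in A v = d}"

text \<open>
  Bivariate integer polynomials are represented by their values at elements \<open>x\<close>, \<open>y\<close> of an
  arbitrary commutative ring; \<open>int poly poly\<close> with its two indeterminates yields the formal
  polynomials.  The definition is meant for \<open>n \<ge> 1\<close> only.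
\<close>

definition andre_poly :: "nat \<Rightarrow> 'a::comm_ring_1 \<Rightarrow> 'a \<Rightarrow> 'a" where
  "andre_poly n x y =
     (\<Sum>T \<in> trees012 (n - 1). x ^ num_of_degree 0 (n - 1) T * y ^ num_of_degree 1 (n - 1) T)"

text \<open>Only the values at \<open>n \<ge> 1\<close> are meaningful, where \<open>k - 1\<close> does not truncate.\<close>

definition e_poly :: "nat \<Rightarrow> 'a::comm_ring_1 \<Rightarrow> 'a \<Rightarrow> 'a" where
  "e_poly n x y =
     (if odd n
      then let k = (n + 1) div 2 in (-1) ^ (k - 1) * y * (2 * x - y\<^sup>2) ^ (k - 1)
      else let k = n div 2 in (-1) ^ (k - 1) * (x - y\<^sup>2) * (2 * x - y\<^sup>2) ^ (k - 1))"

text \<open>The matrix entries, with row and column indices starting from 1.\<close>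

definition hess_entry :: "'a::comm_ring_1 \<Rightarrow> 'a \<Rightarrow> nat \<Rightarrow> nat \<Rightarrow> 'a" where
  "hess_entry x y i j =
     (if j = 1 then x * e_poly i x y
      else if j \<le> i then of_nat (i choose (j - 1)) * e_poly (i - j + 1) x y
      else if j = i + 1 then -1
      else 0)"

text \<open>Indices of \<^const>\<open>mat\<close> start from 0, hence the shift.\<close>

definition hess_matrix :: "nat \<Rightarrow> 'a::comm_ring_1 \<Rightarrow> 'a \<Rightarrow> 'a mat" where
  "hess_matrix n x y = mat n n (\<lambda>(i, j). hess_entry x y (i + 1) (j + 1))"

end

theory Submission
  imports Defs
begin

text \<open>
  Let \<open>X\<close> be the exponential generating function of the polynomials \<open>E\<^sub>n\<^sub>+\<^sub>1\<close>.  Growing increasing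
  trees by attaching the vertex with the largest label turns a leaf into a vertex of degree one
  plus a new leaf, and a vertex of degree one into a vertex of degree two plus a new leaf.  On
  the weights this is the derivation \<open>x \<mapsto> x y\<close>, \<open>y \<mapsto> x\<close>.  Hence, if \<open>X\<close> and \<open>Y\<close> are power series
  with \<open>X' = X Y\<close>, \<open>Y' = X\<close> and constant terms \<open>x\<close>, \<open>y\<close>, then the \<open>n\<close>-th derivative of \<open>X\<close> is the
  sum over trees with \<open>X\<close> and \<open>Y\<close> in place of \<open>x\<close> and \<open>y\<close>, and its constant term says that
  \<open>X\<close> is indeed the generating function (\<open>andre_poly_eq_hcoeff\<close>).

  Such series can be written down explicitly.  Let \<open>h = 1 - e\<close>, where \<open>e\<close> is the exponential
  generating function of the \<open>e\<^sub>n\<close>.  The case distinction in the definition of \<open>e\<^sub>n\<close> is the solution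
  of a two-step linear recurrence, which reads \<open>h'' = x - (2 x - y\<^sup>2) h\<close> and has the first integral
  \<open>h'\<^sup>2 = 2 x h - (2 x - y\<^sup>2) h\<^sup>2\<close>.  These two equations show that \<open>X = x / h\<close> and \<open>Y = - h' / h\<close>
  satisfy the system above.  Comparing coefficients in \<open>X h = x\<close> expresses each \<open>E\<^sub>n\<^sub>+\<^sub>1\<close> linearly by
  the previous ones (\<open>andre_poly_recurrence\<close>), and a linear recurrence of this kind is solved by a
  Hessenberg determinant (\<open>det_hessenberg\<close>).

  The ground ring is an arbitrary commutative ring, so factorials need not be invertible.  The
  generating functions therefore live in the ring of Hurwitz series, whose multiplication is the
  binomial convolution of coefficient sequences.
\<close>

section \<open>Hurwitz series\<close>

text \<open>
  The sequence \<open>f\<close> stands for the formal exponential series with the terms \<open>f n * z ^ n / n!\<close>.  The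
  derivative is then a mere shift, so a series is determined by its derivative and its constant
  term in every characteristic.
\<close>

typedef 'a hurwitz = "UNIV :: (nat \<Rightarrow> 'a) set"
  morphisms hcoeff Abs_hurwitz ..

setup_lifting type_definition_hurwitz

lemma hurwitz_eqI: "(\<And>n. hcoeff f n = hcoeff g n) \<Longrightarrow> f = g"
  by (simp add: hcoeff_inject[symmetric] fun_eq_iff)

instantiation hurwitz :: (comm_ring_1) "{zero, one, plus, minus, uminus, times}"
begin

lift_definition zero_hurwitz :: "'a hurwitz" is "\<lambda>n. 0" .
lift_definition one_hurwitz :: "'a hurwitz" is "\<lambda>n. if n = 0 then 1 else 0" .
lift_definition plus_hurwitz :: "'a hurwitz \<Rightarrow> 'a hurwitz \<Rightarrow> 'a hurwitz"
  is "\<lambda>f g n. f n + g n" .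
lift_definition minus_hurwitz :: "'a hurwitz \<Rightarrow> 'a hurwitz \<Rightarrow> 'a hurwitz"
  is "\<lambda>f g n. f n - g n" .
lift_definition uminus_hurwitz :: "'a hurwitz \<Rightarrow> 'a hurwitz"
  is "\<lambda>f n. - f n" .
lift_definition times_hurwitz :: "'a hurwitz \<Rightarrow> 'a hurwitz \<Rightarrow> 'a hurwitz"
  is "\<lambda>f g n. \<Sum>k\<le>n. of_nat (n choose k) * f k * g (n - k)" .

instance ..

end

lift_definition hderiv :: "'a hurwitz \<Rightarrow> 'a hurwitz" is "\<lambda>f n. f (Suc n)" .

lift_definition hconst :: "'a::comm_ring_1 \<Rightarrow> 'a hurwitz" is "\<lambda>a n. if n = 0 then a else 0" .

lemmas hcoeff_simps [simp] =
  zero_hurwitz.rep_eq one_hurwitz.rep_eq plus_hurwitz.rep_eq minus_hurwitz.rep_eq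
  uminus_hurwitz.rep_eq hderiv.rep_eq hconst.rep_eq

lemma hderiv_linear [simp]:
  fixes f g :: "'a::comm_ring_1 hurwitz"
  shows "hderiv (f + g) = hderiv f + hderiv g" "hderiv (f - g) = hderiv f - hderiv g"
    "hderiv (- f) = - hderiv f" "hderiv 0 = (0 :: 'a hurwitz)" "hderiv 1 = (0 :: 'a hurwitz)"
    "hderiv (hconst a) = (0 :: 'a hurwitz)"
  by (auto intro!: hurwitz_eqI)

lemma hcoeff_mult_0 [simp]: "hcoeff (f * g) 0 = hcoeff f 0 * hcoeff g 0"
  by (simp add: times_hurwitz.rep_eq)

text \<open>
  This is the product rule, in a form that does not presuppose the ring laws; it amounts to
  Pascal's rule for the binomial coefficients.  Since it lowers the index, the ring laws follow
  from it by induction on the index of the coefficient.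
\<close>

lemma hcoeff_mult_Suc:
  fixes f g :: "'a::comm_ring_1 hurwitz"
  shows "hcoeff (f * g) (Suc n) = hcoeff (hderiv f * g) n + hcoeff (f * hderiv g) n"
proof -
  let ?t = "\<lambda>k. hcoeff f k * hcoeff g (Suc n - k)"
  have "hcoeff (f * g) (Suc n) = (\<Sum>k\<le>Suc n. of_nat (Suc n choose k) * ?t k)"
    by (simp add: times_hurwitz.rep_eq mult.assoc)
  also have "\<dots> = ?t 0 + (\<Sum>k\<le>n. of_nat (Suc n choose Suc k) * ?t (Suc k))"
    by (subst sum.atMost_Suc_shift) simp
  also have "\<dots> = (\<Sum>k\<le>n. of_nat (n choose k) * ?t (Suc k))
      + (?t 0 + (\<Sum>k\<le>n. of_nat (n choose Suc k) * ?t (Suc k)))"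
    by (simp add: algebra_simps sum.distrib)
  also have "?t 0 + (\<Sum>k\<le>n. of_nat (n choose Suc k) * ?t (Suc k))
      = (\<Sum>k\<le>Suc n. of_nat (n choose k) * ?t k)"
    by (subst sum.atMost_Suc_shift) simp
  also have "\<dots> = (\<Sum>k\<le>n. of_nat (n choose k) * ?t k)"
    by (simp add: binomial_eq_0)
  also have "\<dots> = hcoeff (f * hderiv g) n"
    by (simp add: times_hurwitz.rep_eq mult.assoc Suc_diff_le)
  finally show ?thesis
    by (simp add: times_hurwitz.rep_eq mult.assoc)
qed

instance hurwitz :: (comm_ring_1) comm_ring_1
proof
  fix a b c :: "'a hurwitz"
  have distrib: "hcoeff ((f + g) * h) n = hcoeff (f * h) n + hcoeff (g * h) n"
    "hcoeff (h * (f + g)) n = hcoeff (h * f) n + hcoeff (h * g) n"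
    for f g h :: "'a hurwitz" and n
    by (simp_all add: times_hurwitz.rep_eq algebra_simps sum.distrib)
  have deriv: "hderiv (f * g) = hderiv f * g + f * hderiv g" for f g :: "'a hurwitz"
    by (rule hurwitz_eqI) (simp add: hcoeff_mult_Suc)
  have "hcoeff (a * b * c) n = hcoeff (a * (b * c)) n" for n
    by (induction n arbitrary: a b c) (simp_all add: hcoeff_mult_Suc deriv distrib mult.assoc add.assoc)
  then show "a * b * c = a * (b * c)"
    by (rule hurwitz_eqI)
  have "hcoeff (a * b) n = hcoeff (b * a) n" for n
    by (induction n arbitrary: a b) (simp_all add: hcoeff_mult_Suc mult.commute add.commute)
  then show "a * b = b * a"
    by (rule hurwitz_eqI)
  show "(a + b) * c = a * c + b * c"
    by (rule hurwitz_eqI) (simp add: distrib)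
  have "hcoeff (0 * a) n = 0" for a :: "'a hurwitz" and n
    by (simp add: times_hurwitz.rep_eq)
  then have "hcoeff (1 * a) n = hcoeff a n" for n
    by (induction n arbitrary: a) (simp_all add: hcoeff_mult_Suc)
  then show "1 * a = a"
    by (rule hurwitz_eqI)
  have "hcoeff (0 :: 'a hurwitz) 0 \<noteq> hcoeff 1 0"
    by simp
  then show "(0 :: 'a hurwitz) \<noteq> 1"
    by metis
qed (auto intro!: hurwitz_eqI simp: algebra_simps)

lemma hderiv_mult [simp]: "hderiv (f * g) = hderiv f * g + f * hderiv (g :: 'a::comm_ring_1 hurwitz)"
  by (rule hurwitz_eqI) (simp add: hcoeff_mult_Suc)

lemma hurwitz_2 [simp]:
  "hcoeff (2 :: 'a::comm_ring_1 hurwitz) 0 = 2" "hderiv (2 :: 'a hurwitz) = 0"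
proof -
  have "hcoeff (1 + 1 :: 'a hurwitz) 0 = 1 + 1" "hderiv (1 + 1 :: 'a hurwitz) = 0"
    by (simp_all only: plus_hurwitz.rep_eq one_hurwitz.rep_eq hderiv_linear simp_thms if_True add_0_left)
  then show "hcoeff (2 :: 'a hurwitz) 0 = 2" "hderiv (2 :: 'a hurwitz) = 0"
    by (simp_all only: one_add_one)
qed

lemma hderiv_power2 [simp]: "hderiv (f\<^sup>2) = 2 * f * hderiv (f :: 'a::comm_ring_1 hurwitz)"
  by (simp add: power2_eq_square algebra_simps)

lemma hcoeff_power2_0 [simp]: "hcoeff (f\<^sup>2) 0 = (hcoeff (f :: 'a::comm_ring_1 hurwitz) 0)\<^sup>2"
  by (simp add: power2_eq_square)

lemma hderiv_sum: "hderiv (\<Sum>i\<in>S. f i) = (\<Sum>i\<in>S. hderiv (f i :: 'a::comm_ring_1 hurwitz))"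
  by (induction S rule: infinite_finite_induct) auto

lemma hderiv_prod:
  fixes f :: "'b \<Rightarrow> 'a::comm_ring_1 hurwitz"
  assumes "finite S"
  shows "hderiv (\<Prod>i\<in>S. f i) = (\<Sum>i\<in>S. hderiv (f i) * (\<Prod>j\<in>S - {i}. f j))"
  using assms
proof (induction S)
  case (insert a S)
  have "(\<Prod>j\<in>insert a S - {i}. f j) = f a * (\<Prod>j\<in>S - {i}. f j)" if "i \<in> S" for i
  proof -
    have "insert a S - {i} = insert a (S - {i})"
      using insert.hyps that by auto
    then show ?thesis
      using insert.hyps by simp
  qed
  then show ?case
    using insert by (simp add: sum_distrib_left mult.left_commute)
qed simp

lemma hcoeff_0_sum: "hcoeff (\<Sum>i\<in>S. f i) 0 = (\<Sum>i\<in>S. hcoeff (f i :: 'a::comm_ring_1 hurwitz) 0)"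
  by (induction S rule: infinite_finite_induct) auto

lemma hcoeff_0_prod: "hcoeff (\<Prod>i\<in>S. f i) 0 = (\<Prod>i\<in>S. hcoeff (f i :: 'a::comm_ring_1 hurwitz) 0)"
  by (induction S rule: infinite_finite_induct) auto

lemma hcoeff_funpow_hderiv: "hcoeff ((hderiv ^^ n) f) k = hcoeff f (n + k)"
  by (induction n arbitrary: k) auto

lemma hderiv_eq_0_imp_hconst:
  assumes "hderiv f = 0"
  shows "f = hconst (hcoeff f 0 :: 'a::comm_ring_1)"
proof (rule hurwitz_eqI)
  fix n
  show "hcoeff f n = hcoeff (hconst (hcoeff f 0)) n"
    using arg_cong[OF assms, of "\<lambda>h. hcoeff h (n - 1)"] by (cases n) auto
qed

lemma hcoeff_hconst_mult:
  "hcoeff (hconst a * f) n = a * hcoeff f n" "hcoeff (f * hconst a) n = a * hcoeff f n"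
proof -
  show "hcoeff (hconst a * f) n = a * hcoeff f n"
    by (induction n arbitrary: f) (simp_all add: hcoeff_mult_Suc)
  then show "hcoeff (f * hconst a) n = a * hcoeff f n"
    by (simp add: mult.commute)
qed

text \<open>Only sequences that start with 1 are to be inverted, hence the value at 0.\<close>

fun inverse_coeff :: "(nat \<Rightarrow> 'a::comm_ring_1) \<Rightarrow> nat \<Rightarrow> 'a" where
  "inverse_coeff f n =
     (if n = 0 then 1 else - (\<Sum>k<n. of_nat (n choose k) * inverse_coeff f k * f (n - k)))"

declare inverse_coeff.simps [simp del]

lemma hurwitz_inverse_exists:
  fixes f :: "'a::comm_ring_1 hurwitz"
  assumes "hcoeff f 0 = 1"
  obtains g where "g * f = 1"
proof
  let ?g = "inverse_coeff (hcoeff f)"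
  have "(\<Sum>k\<le>n. of_nat (n choose k) * ?g k * hcoeff f (n - k)) = (if n = 0 then 1 else 0)" for n
  proof (cases n)
    case 0
    then show ?thesis
      using assms by (simp add: inverse_coeff.simps)
  next
    case (Suc m)
    have "(\<Sum>k\<le>n. of_nat (n choose k) * ?g k * hcoeff f (n - k)) =
      (\<Sum>k<n. of_nat (n choose k) * ?g k * hcoeff f (n - k)) + ?g n"
      using assms by (simp add: lessThan_Suc_atMost[symmetric])
    also have "\<dots> = 0"
      by (subst (2) inverse_coeff.simps) (use Suc in simp)
    finally show ?thesis using Suc by simp
  qed
  then show "Abs_hurwitz ?g * f = 1"
    by (intro hurwitz_eqI) (simp add: times_hurwitz.rep_eq Abs_hurwitz_inverse)
qed


section \<open>Increasing trees and derivations\<close>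

text \<open>
  If every arc increases, then nothing enters the root, and climbing from a vertex to its parent
  must end in the root; so unique parents suffice for a tree.
\<close>

lemma increasing_trees_iff:
  "A \<in> increasing_trees n \<longleftrightarrow>
     A \<subseteq> {0..n} \<times> {0..n} \<and> (\<forall>(u, v) \<in> A. u < v) \<and> (\<forall>v \<in> {1..n}. \<exists>!u. (u, v) \<in> A)"
  (is "_ \<longleftrightarrow> ?R")
proof
  have *: "{0..n} - {0} = {1..n}" by auto
  show "A \<in> increasing_trees n \<Longrightarrow> ?R"
    unfolding increasing_trees_def rooted_tree_def * by blast
  assume R: ?R
  have "(0, v) \<in> A\<^sup>*" if "v \<le> n" for v
    using that
  proof (induction v rule: less_induct)
    case (less v)
    show ?case
    proof (cases "v = 0")
      case False
      then obtain u where "(u, v) \<in> A"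
        using R less.prems by (metis One_nat_def Suc_leI atLeastAtMost_iff neq0_conv)
      moreover from this have "u < v"
        using R by auto
      ultimately show ?thesis
        using less by (meson less_imp_le order_trans rtrancl.rtrancl_into_rtrancl)
    qed simp
  qed
  then show "A \<in> increasing_trees n"
    using R unfolding increasing_trees_def rooted_tree_def * by fastforce
qed

lemma increasing_treesD:
  assumes "A \<in> increasing_trees n" "(u, v) \<in> A"
  shows "u < v" "v \<le> n"
  using assms unfolding increasing_trees_iff by auto

lemma finite_increasing_trees: "finite (increasing_trees n)"
proof (rule finite_subset)
  show "increasing_trees n \<subseteq> Pow ({0..n} \<times> {0..n})"
    by (simp add: subset_iff[of "increasing_trees n"] increasing_trees_iff)
qed simp

lemma increasing_trees_0: "increasing_trees 0 = {{}}"
proof -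
  have "A = {}" if "A \<in> increasing_trees 0" for A
    using increasing_treesD[OF that] by fastforce
  moreover have "{} \<in> increasing_trees 0"
    by (simp add: increasing_trees_iff)
  ultimately show ?thesis by blast
qed

text \<open>
  The largest label is always a leaf, and every other vertex may serve as its parent.
\<close>

lemma bij_betw_attach_leaf:
  "bij_betw (\<lambda>(A, p). insert (p, Suc n) A)
     (increasing_trees n \<times> {0..n}) (increasing_trees (Suc n))"
proof (rule bij_betw_imageI)
  show "inj_on (\<lambda>(A, p). insert (p, Suc n) A) (increasing_trees n \<times> {0..n})"
  proof (rule inj_onI, clarsimp)
    fix A B p q
    assume A: "A \<in> increasing_trees n" and B: "B \<in> increasing_trees n"
      and eq: "insert (p, Suc n) A = insert (q, Suc n) B"
    have nA: "(u, Suc n) \<notin> A" and nB: "(u, Suc n) \<notin> B" for u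
      using increasing_treesD[OF A] increasing_treesD[OF B] by fastforce+
    have pq: "p = q" using eq nA nB by blast
    have "A = insert (p, Suc n) A - {(p, Suc n)}"
      using nA by simp
    also have "\<dots> = insert (q, Suc n) B - {(q, Suc n)}"
      unfolding eq unfolding pq ..
    also have "\<dots> = B"
      using nB by simp
    finally show "A = B \<and> p = q"
      using pq by simp
  qed
  show "(\<lambda>(A, p). insert (p, Suc n) A) ` (increasing_trees n \<times> {0..n}) = increasing_trees (Suc n)"
  proof (intro equalityI subsetI)
    fix B assume "B \<in> (\<lambda>(A, p). insert (p, Suc n) A) ` (increasing_trees n \<times> {0..n})"
    then obtain A p where A: "A \<in> increasing_trees n" and p: "p \<le> n"
      and B: "B = insert (p, Suc n) A" by auto
    have "\<exists>!u. (u, v) \<in> B" if "v \<in> {1..Suc n}" for v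
    proof (cases "v = Suc n")
      case True
      then show ?thesis
        using increasing_treesD[OF A] unfolding B by fastforce
    next
      case False
      then have "\<exists>!u. (u, v) \<in> A"
        using that A unfolding increasing_trees_iff by auto
      then show ?thesis
        using False unfolding B by auto
    qed
    moreover have "B \<subseteq> {0..Suc n} \<times> {0..Suc n}" "\<forall>(u, v) \<in> B. u < v"
      using A p unfolding increasing_trees_iff B by auto
    ultimately show "B \<in> increasing_trees (Suc n)"
      unfolding increasing_trees_iff by blast
  next
    fix B assume B: "B \<in> increasing_trees (Suc n)"
    then have ex1: "\<exists>!u. (u, v) \<in> B" if "v \<in> {1..Suc n}" for v
      using that unfolding increasing_trees_iff by blast
    then obtain p where p: "(p, Suc n) \<in> B"
      by (metis atLeastAtMost_iff le_add1 order_refl plus_1_eq_Suc)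
    define A where "A = B - {(p, Suc n)}"
    have nA: "(u, Suc n) \<notin> A" for u
      using ex1[of "Suc n"] p unfolding A_def by auto
    have "A \<subseteq> {0..n} \<times> {0..n}"
    proof
      fix a assume "a \<in> A"
      moreover obtain u v where a: "a = (u, v)" by fastforce
      ultimately have "u < v" "v \<le> Suc n" "v \<noteq> Suc n"
        using increasing_treesD[OF B] nA unfolding A_def by auto
      then show "a \<in> {0..n} \<times> {0..n}" using a by auto
    qed
    moreover have "\<exists>!u. (u, v) \<in> A" if "v \<in> {1..n}" for v
      using ex1[of v] that unfolding A_def by auto
    ultimately have "A \<in> increasing_trees n"
      using B unfolding increasing_trees_iff A_def by auto
    moreover have "p \<le> n" "B = insert (p, Suc n) A"
      using increasing_treesD[OF B p] p unfolding A_def by auto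
    ultimately show "B \<in> (\<lambda>(A, p). insert (p, Suc n) A) ` (increasing_trees n \<times> {0..n})"
      by force
  qed
qed

lemma degree_in_attach_leaf:
  assumes "A \<in> increasing_trees n" "p \<le> n"
  shows "degree_in (insert (p, Suc n) A) v = (if v = p then Suc (degree_in A v) else degree_in A v)"
    and "degree_in A (Suc n) = 0"
proof -
  have sub: "{w. (v, w) \<in> A} \<subseteq> {0..n}" for v
    using increasing_treesD[OF assms(1)] by auto
  have "{w. (v, w) \<in> insert (p, Suc n) A} =
    (if v = p then insert (Suc n) {w. (v, w) \<in> A} else {w. (v, w) \<in> A})"
    by auto
  moreover have "Suc n \<notin> {w. (v, w) \<in> A}" "finite {w. (v, w) \<in> A}"
    using sub[of v] finite_subset by auto
  ultimately show "degree_in (insert (p, Suc n) A) v =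
      (if v = p then Suc (degree_in A v) else degree_in A v)"
    unfolding degree_in_def by (cases "v = p") (simp_all del: insert_iff)
  have "{w. (Suc n, w) \<in> A} = {}"
    using increasing_treesD[OF assms(1)] by fastforce
  then show "degree_in A (Suc n) = 0"
    unfolding degree_in_def by simp
qed

text \<open>
  By the product rule, differentiating a product over the vertices of a tree amounts to choosing
  one vertex \<open>p\<close> of degree \<open>d\<close> and replacing its factor \<open>\<phi> d\<close> by \<open>\<phi> 0 * \<phi> (Suc d)\<close>.  This is the
  product for the tree with a new leaf attached to \<open>p\<close>.
\<close>

lemma funpow_hderiv_eq_tree_sum:
  fixes \<phi> :: "nat \<Rightarrow> 'a::comm_ring_1 hurwitz"
  assumes "\<And>d. hderiv (\<phi> d) = \<phi> 0 * \<phi> (Suc d)"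
  shows "(hderiv ^^ n) (\<phi> 0) = (\<Sum>A\<in>increasing_trees n. \<Prod>v\<in>{0..n}. \<phi> (degree_in A v))"
proof (induction n)
  case 0
  show ?case by (simp add: increasing_trees_0 degree_in_def)
next
  case (Suc n)
  have attach: "hderiv (\<phi> (degree_in A p)) * (\<Prod>v\<in>{0..n} - {p}. \<phi> (degree_in A v)) =
      (\<Prod>v\<in>{0..Suc n}. \<phi> (degree_in (insert (p, Suc n) A) v))"
    if "A \<in> increasing_trees n" "p \<in> {0..n}" for A p
  proof -
    have "(\<Prod>v\<in>{0..n} - {p}. \<phi> (degree_in (insert (p, Suc n) A) v)) =
        (\<Prod>v\<in>{0..n} - {p}. \<phi> (degree_in A v))"
      using that by (intro prod.cong) (auto simp: degree_in_attach_leaf)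
    then have "(\<Prod>v\<in>{0..n}. \<phi> (degree_in (insert (p, Suc n) A) v)) =
        \<phi> (Suc (degree_in A p)) * (\<Prod>v\<in>{0..n} - {p}. \<phi> (degree_in A v))"
      using that by (subst prod.remove[of _ p]) (simp_all add: degree_in_attach_leaf)
    moreover have "degree_in (insert (p, Suc n) A) (Suc n) = 0"
      using that by (simp add: degree_in_attach_leaf)
    ultimately show ?thesis
      by (simp add: prod.atLeast0_atMost_Suc assms mult_ac)
  qed
  have "(hderiv ^^ Suc n) (\<phi> 0) =
      (\<Sum>A\<in>increasing_trees n. hderiv (\<Prod>v\<in>{0..n}. \<phi> (degree_in A v)))"
    using Suc.IH by (simp add: hderiv_sum)
  also have "\<dots> = (\<Sum>A\<in>increasing_trees n. \<Sum>p\<in>{0..n}.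
      \<Prod>v\<in>{0..Suc n}. \<phi> (degree_in (insert (p, Suc n) A) v))"
    by (intro sum.cong refl) (simp only: hderiv_prod[OF finite_atLeastAtMost] attach cong: sum.cong)
  also have "\<dots> = (\<Sum>(A, p)\<in>increasing_trees n \<times> {0..n}.
      \<Prod>v\<in>{0..Suc n}. \<phi> (degree_in (insert (p, Suc n) A) v))"
    by (rule sum.cartesian_product)
  also have "\<dots> = (\<Sum>B\<in>increasing_trees (Suc n). \<Prod>v\<in>{0..Suc n}. \<phi> (degree_in B v))"
    by (subst sum.reindex_bij_betw[OF bij_betw_attach_leaf, symmetric])
      (simp add: case_prod_unfold)
  finally show ?case .
qed

text \<open>
  The weight 0 for degrees above two lets the sum run over all increasing trees; it is also
  what makes the hypothesis of \<open>funpow_hderiv_eq_tree_sum\<close> hold for degree two.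
\<close>

definition vertex_weight :: "'a::comm_ring_1 \<Rightarrow> 'a \<Rightarrow> nat \<Rightarrow> 'a" where
  "vertex_weight x y d = (if d = 0 then x else if d = 1 then y else if d = 2 then 1 else 0)"

lemma andre_poly_eq_vertex_weights:
  "andre_poly (n + 1) x y =
     (\<Sum>A\<in>increasing_trees n. \<Prod>v\<in>{0..n}. vertex_weight x y (degree_in A v))"
proof -
  have weight: "x ^ num_of_degree 0 n A * y ^ num_of_degree 1 n A =
      (\<Prod>v\<in>{0..n}. vertex_weight x y (degree_in A v))" if "A \<in> trees012 n" for A
  proof -
    have "(\<Prod>v\<in>{0..n}. vertex_weight x y (degree_in A v)) =
        (\<Prod>v\<in>{0..n}. (if degree_in A v = 0 then x else 1) * (if degree_in A v = 1 then y else 1))"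
    proof (rule prod.cong)
      fix v assume "v \<in> {0..n}"
      then have "degree_in A v \<le> 2"
        using that unfolding trees012_def by auto
      then show "vertex_weight x y (degree_in A v) =
          (if degree_in A v = 0 then x else 1) * (if degree_in A v = 1 then y else 1)"
        by (auto simp: vertex_weight_def)
    qed simp
    also have "\<dots> = x ^ num_of_degree 0 n A * y ^ num_of_degree 1 n A"
      by (simp only: prod.distrib num_of_degree_def prod.inter_filter[OF finite_atLeastAtMost, symmetric]
        prod_constant)
    finally show ?thesis ..
  qed
  have vanish: "(\<Prod>v\<in>{0..n}. vertex_weight x y (degree_in A v)) = 0"
    if A: "A \<in> increasing_trees n - trees012 n" for A
  proof -
    obtain v where "v \<in> {0..n}" "degree_in A v > 2"
      using A unfolding trees012_def by force
    then have "\<exists>v\<in>{0..n}. vertex_weight x y (degree_in A v) = 0"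
      by (intro bexI[of _ v]) (auto simp: vertex_weight_def)
    then obtain w where "w \<in> {0..n}" "vertex_weight x y (degree_in A w) = 0" by blast
    then show ?thesis
      by (subst prod.remove) auto
  qed
  have "andre_poly (n + 1) x y =
      (\<Sum>A\<in>trees012 n. \<Prod>v\<in>{0..n}. vertex_weight x y (degree_in A v))"
    by (simp add: andre_poly_def weight del: One_nat_def)
  also have "\<dots> = (\<Sum>A\<in>increasing_trees n. \<Prod>v\<in>{0..n}. vertex_weight x y (degree_in A v))"
    by (rule sum.mono_neutral_left)
      (use vanish in \<open>auto simp: trees012_def finite_increasing_trees\<close>)
  finally show ?thesis .
qed

section \<open>The exponential generating function of the Andre polynomials\<close>

text \<open>
  The polynomial with \<open>X\<close> and \<open>Y\<close> substituted for its variables is a derivative of \<open>X\<close>; taking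
  constant terms is a ring homomorphism, which brings the variables back to the ground ring.
\<close>

lemma andre_poly_eq_hcoeff:
  fixes X Y :: "'a::comm_ring_1 hurwitz"
  assumes "hderiv X = X * Y" "hderiv Y = X"
  shows "andre_poly (n + 1) (hcoeff X 0) (hcoeff Y 0) = hcoeff X n"
proof -
  have "hderiv (vertex_weight X Y d) = vertex_weight X Y 0 * vertex_weight X Y (Suc d)" for d
    using assms by (auto simp: vertex_weight_def)
  from funpow_hderiv_eq_tree_sum[of "vertex_weight X Y", OF this]
  have "hcoeff X n = hcoeff (\<Sum>A\<in>increasing_trees n. \<Prod>v\<in>{0..n}. vertex_weight X Y (degree_in A v)) 0"
    using hcoeff_funpow_hderiv[of n X 0] by (simp add: vertex_weight_def)
  moreover have "hcoeff (vertex_weight X Y d) 0 = vertex_weight (hcoeff X 0) (hcoeff Y 0) d" for d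
    by (simp add: vertex_weight_def)
  ultimately show ?thesis
    by (simp only: andre_poly_eq_vertex_weights hcoeff_0_sum hcoeff_0_prod)
qed

lemma e_poly_Suc_Suc:
  "n > 0 \<Longrightarrow> e_poly (Suc (Suc n)) x y = - (2 * x - y\<^sup>2) * e_poly n x y"
proof -
  assume "n > 0"
  show ?thesis
  proof (cases "odd n")
    case True
    then obtain k where "n = Suc (2 * k)" by (metis oddE Suc_eq_plus1)
    then show ?thesis by (simp add: e_poly_def Let_def algebra_simps)
  next
    case False
    then obtain k where "n = 2 * Suc k" using \<open>n > 0\<close> by (metis evenE gr0_implies_Suc mult_0_right neq0_conv)
    then show ?thesis by (simp add: e_poly_def Let_def algebra_simps)
  qed
qed

text \<open>
  This is \<open>1 - e\<close>, the denominator of the generating function.  The value of \<open>e_poly\<close> at 0 is not the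
  constant term of \<open>e\<close>, which is 0.
\<close>

lift_definition denominator_series :: "'a::comm_ring_1 \<Rightarrow> 'a \<Rightarrow> 'a hurwitz" is
  "\<lambda>x y n. if n = 0 then 1 else - e_poly n x y" .

lemma hderiv_hderiv_denominator_series:
  "hderiv (hderiv (denominator_series x y)) =
     hconst x - hconst (2 * x - y\<^sup>2) * denominator_series x y"
proof (rule hurwitz_eqI)
  fix n
  show "hcoeff (hderiv (hderiv (denominator_series x y))) n =
    hcoeff (hconst x - hconst (2 * x - y\<^sup>2) * denominator_series x y) n"
    by (cases n) (simp_all add: denominator_series.rep_eq hcoeff_hconst_mult e_poly_Suc_Suc
      e_poly_def[of 2, simplified] numeral_2_eq_2[symmetric] algebra_simps)
qed

text \<open>
  The difference of the two sides has derivative 0 by the differential equation of second order,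
  and its constant term vanishes too.
\<close>

lemma square_hderiv_denominator_series:
  fixes x y :: "'a::comm_ring_1"
  defines "h \<equiv> denominator_series x y"
  shows "(hderiv h)\<^sup>2 = 2 * hconst x * h - hconst (2 * x - y\<^sup>2) * h\<^sup>2"
proof -
  define d where "d = (hderiv h)\<^sup>2 - (2 * hconst x * h - hconst (2 * x - y\<^sup>2) * h\<^sup>2)"
  have "hderiv d = 0"
    unfolding d_def by (simp add: hderiv_hderiv_denominator_series h_def algebra_simps)
  moreover have "hcoeff d 0 = 0"
    unfolding d_def
    by (simp add: h_def denominator_series.rep_eq e_poly_def algebra_simps power2_eq_square)
  ultimately have "d = 0"
    using hderiv_eq_0_imp_hconst[of d] by (auto intro!: hurwitz_eqI)
  then show ?thesis unfolding d_def by simp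
qed

lemma andre_poly_recurrence:
  fixes x y :: "'a::comm_ring_1"
  shows "andre_poly 1 x y = x"
    and "n > 0 \<Longrightarrow> andre_poly (n + 1) x y =
      (\<Sum>k<n. of_nat (n choose k) * e_poly (n - k) x y * andre_poly (k + 1) x y)"
proof -
  define h where "h = denominator_series x y"
  have h0: "hcoeff h 0 = 1" "hcoeff h (Suc 0) = - y"
    by (simp_all add: h_def denominator_series.rep_eq e_poly_def)
  obtain g where g: "g * h = 1"
    using hurwitz_inverse_exists h0(1) by blast
  have g0: "hcoeff g 0 = 1"
    using arg_cong[OF g, of "\<lambda>f. hcoeff f 0"] h0 by simp
  define X where "X = hconst x * g"
  define Y where "Y = - (hderiv h * g)"
  have "hderiv g * h + g * hderiv h = 0"
    using arg_cong[OF g, of hderiv] by simp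
  then have "hderiv g * h = - (g * hderiv h)"
    by (simp only: add_eq_0_iff2)
  then have "g * (hderiv g * h) = g * - (g * hderiv h)"
    by (rule arg_cong)
  also have "g * (hderiv g * h) = hderiv g"
    by (subst mult.left_commute) (simp add: g)
  finally have dg: "hderiv g = - (hderiv h * g\<^sup>2)"
    by (simp add: power2_eq_square mult_ac)
  have dX: "hderiv X = X * Y"
    unfolding X_def Y_def by (simp add: dg power2_eq_square algebra_simps)
  have "hderiv Y = - (hderiv (hderiv h) * g) + (hderiv h)\<^sup>2 * g\<^sup>2"
    unfolding Y_def by (simp add: dg power2_eq_square algebra_simps)
  also have "\<dots> = - ((hconst x - hconst (2 * x - y\<^sup>2) * h) * g) +
      (2 * hconst x * h - hconst (2 * x - y\<^sup>2) * h\<^sup>2) * g\<^sup>2"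
    unfolding h_def hderiv_hderiv_denominator_series square_hderiv_denominator_series ..
  also have "\<dots> = - (hconst x * g) + hconst (2 * x - y\<^sup>2) * (g * h)
      + 2 * hconst x * g * (g * h) - hconst (2 * x - y\<^sup>2) * (g * h)\<^sup>2"
    by (simp add: power2_eq_square algebra_simps)
  also have "\<dots> = X"
    unfolding X_def g by simp
  finally have dY: "hderiv Y = X" .
  have andre: "andre_poly (n + 1) x y = hcoeff X n" for n
    using andre_poly_eq_hcoeff[OF dX dY, of n] by (simp add: X_def Y_def g0 h0)
  then show "andre_poly 1 x y = x"
    using andre[of 0] by (simp add: X_def g0)
  have "X * h = hconst x"
    unfolding X_def using g by (simp add: mult.assoc)
  then have eq: "(\<Sum>k\<le>n. of_nat (n choose k) * hcoeff X k * hcoeff h (n - k)) = (if n = 0 then x else 0)"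
    for n
    unfolding times_hurwitz.rep_eq[of X h, THEN fun_cong, symmetric] by simp
  assume "n > 0"
  have "(\<Sum>k\<le>n. of_nat (n choose k) * hcoeff X k * hcoeff h (n - k)) =
      (\<Sum>k<n. of_nat (n choose k) * hcoeff X k * hcoeff h (n - k)) + hcoeff X n"
    using h0 by (simp add: lessThan_Suc_atMost[symmetric])
  also have "(\<Sum>k<n. of_nat (n choose k) * hcoeff X k * hcoeff h (n - k)) =
      - (\<Sum>k<n. of_nat (n choose k) * e_poly (n - k) x y * hcoeff X k)"
    unfolding sum_negf[symmetric]
    by (intro sum.cong) (auto simp: h_def denominator_series.rep_eq algebra_simps)
  finally show "andre_poly (n + 1) x y =
      (\<Sum>k<n. of_nat (n choose k) * e_poly (n - k) x y * andre_poly (k + 1) x y)"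
    using eq[of n] \<open>n > 0\<close> unfolding andre by (simp add: algebra_simps)
qed

section \<open>Hessenberg determinants\<close>

text \<open>
  By the recurrence, the product of the matrix with the column vector \<open>(v 0, \<dots>, v (n - 1))\<close> is
  \<open>(0, \<dots>, 0, v n)\<close>.  As \<open>v 0 = 1\<close>, the first column may be replaced by this product without changing
  the determinant.  Expansion along the new first column leaves \<open>v n\<close> times a triangular minor
  with \<open>- 1\<close> on its diagonal, whose determinant cancels the sign of the cofactor.
\<close>

lemma det_hessenberg:
  fixes m :: "nat \<Rightarrow> nat \<Rightarrow> 'a::comm_ring_1"
  assumes superdiag: "\<And>i. m i (Suc i) = - 1"
    and zero: "\<And>i j. Suc i < j \<Longrightarrow> m i j = 0"
    and v0: "v 0 = 1"
    and v_Suc: "\<And>i. v (Suc i) = (\<Sum>j\<le>i. m i j * v j)"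
  shows "det (mat n n (\<lambda>(i, j). m i j)) = v n"
proof (cases n)
  case 0
  then show ?thesis using v0 by simp
next
  case (Suc N)
  define M where "M = mat n n (\<lambda>(i, j). m i j)"
  \<comment> \<open>Multiplication by \<open>U\<close> from the right replaces the first column by the product with \<open>v\<close>.\<close>
  define U where "U = mat n n (\<lambda>(i, j). if j = 0 then v i else if i = j then 1 else (0::'a))"
  have M: "M \<in> carrier_mat n n" and U: "U \<in> carrier_mat n n" and MU: "M * U \<in> carrier_mat n n"
    unfolding M_def U_def by auto
  have "det U = prod_list (diag_mat U)"
    by (rule det_lower_triangular[OF _ U]) (auto simp: U_def)
  also have "\<dots> = 1"
    unfolding prod_list_diag_prod by (rule prod.neutral) (use v0 in \<open>auto simp: U_def\<close>)
  finally have detU: "det U = 1" .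
  have entry: "(M * U) $$ (i, j) = (\<Sum>k<n. m i k * U $$ (k, j))" if "i < n" "j < n" for i j
    using that by (simp add: M_def U_def scalar_prod_def lessThan_atLeast0)
  have col: "(M * U) $$ (i, 0) = (if i = N then v n else 0)" if "i < n" for i
  proof -
    have "0 < n" using Suc by simp
    have "(M * U) $$ (i, 0) = (\<Sum>k<n. m i k * v k)"
      unfolding entry[OF that \<open>0 < n\<close>] by (rule sum.cong) (simp_all add: U_def)
    also have "\<dots> = (if i = N then v n else 0)"
    proof (cases "i = N")
      case True
      then show ?thesis using v_Suc[of N] Suc by (simp add: lessThan_Suc_atMost)
    next
      case False
      then have "i < N" using that Suc by simp
      have "(\<Sum>k<n. m i k * v k) = (\<Sum>k\<le>Suc i. m i k * v k)"
      proof (rule sum.mono_neutral_right)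
        show "{..Suc i} \<subseteq> {..<n}"
          using \<open>i < N\<close> Suc by auto
        show "\<forall>k\<in>{..<n} - {..Suc i}. m i k * v k = 0"
          by (simp add: zero)
      qed simp
      also have "\<dots> = 0" using v_Suc[of i] superdiag by simp
      finally show ?thesis using False by simp
    qed
    finally show ?thesis .
  qed
  have other: "(M * U) $$ (i, j) = m i j" if "i < n" "j < n" "j \<noteq> 0" for i j
  proof -
    have "(M * U) $$ (i, j) = (\<Sum>k<n. if k = j then m i k else 0)"
      unfolding entry[OF that(1,2)] by (rule sum.cong) (use that in \<open>auto simp: U_def\<close>)
    then show ?thesis using that by simp
  qed
  define L where "L = mat_delete (M * U) N 0"
  have L: "L \<in> carrier_mat N N"
    using mat_delete_carrier[OF MU, of N 0] by (simp only: L_def Suc diff_Suc_1)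
  have L_entry: "L $$ (i, j) = m i (Suc j)" if "i < N" "j < N" for i j
  proof -
    have "dim_row (M * U) = n" "dim_col (M * U) = n" using MU by auto
    then have "L $$ (i, j) = (M * U) $$ (i, Suc j)"
      unfolding L_def mat_delete_def using that Suc by simp
    then show ?thesis using other that Suc by simp
  qed
  have "det L = prod_list (diag_mat L)"
    by (rule det_lower_triangular[OF _ L]) (simp add: L_entry zero)
  also have "\<dots> = (\<Prod>i = 0..<N. - 1)"
    unfolding prod_list_diag_prod using L by (intro prod.cong) (auto simp: L_entry superdiag)
  finally have detL: "det L = (- 1) ^ N" by simp
  have "det M = det (M * U)"
    using det_mult[OF M U] detU by simp
  also have "\<dots> = (\<Sum>i<n. (M * U) $$ (i, 0) * cofactor (M * U) i 0)"
    by (rule laplace_expansion_column[OF MU]) (use Suc in simp)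
  also have "\<dots> = (\<Sum>i<n. if i = N then v n * cofactor (M * U) i 0 else 0)"
    by (rule sum.cong) (auto simp: col)
  also have "\<dots> = v n * cofactor (M * U) N 0"
    using Suc by simp
  also have "cofactor (M * U) N 0 = 1"
    unfolding cofactor_def L_def[symmetric] detL by simp
  finally show ?thesis unfolding M_def by simp
qed

theorem theorem8:
  fixes x y :: "'a::comm_ring_1" and n :: nat
  assumes "n \<ge> 1"
  shows "andre_poly (n + 1) x y = det (hess_matrix n x y)"
proof -
  \<comment> \<open>The first column of the matrix carries an additional factor \<open>x = E\<^sub>1\<close>, so the vector starts with
    1 instead of \<open>E\<^sub>1\<close>.\<close>
  define v where "v k = (if k = 0 then 1 else andre_poly (k + 1) x y)" for k
  have "det (mat n n (\<lambda>(i, j). hess_entry x y (i + 1) (j + 1))) = v n"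
  proof (rule det_hessenberg)
    show "hess_entry x y (i + 1) (Suc i + 1) = - 1" for i
      by (simp add: hess_entry_def)
    show "Suc i < j \<Longrightarrow> hess_entry x y (i + 1) (j + 1) = 0" for i j
      by (simp add: hess_entry_def)
    show "v 0 = 1"
      by (simp add: v_def)
    show "v (Suc i) = (\<Sum>j\<le>i. hess_entry x y (i + 1) (j + 1) * v j)" for i
    proof -
      have "v (Suc i) =
          (\<Sum>k<Suc i. of_nat (Suc i choose k) * e_poly (Suc i - k) x y * andre_poly (k + 1) x y)"
        using andre_poly_recurrence(2)[of "Suc i" x y] by (simp add: v_def)
      also have "\<dots> = (\<Sum>j\<le>i. hess_entry x y (i + 1) (j + 1) * v j)"
        unfolding lessThan_Suc_atMost
      proof (rule sum.cong)
        fix k assume "k \<in> {..i}"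
        then show "of_nat (Suc i choose k) * e_poly (Suc i - k) x y * andre_poly (k + 1) x y =
            hess_entry x y (i + 1) (k + 1) * v k"
          using andre_poly_recurrence(1)[of x y]
          by (cases "k = 0") (auto simp: hess_entry_def v_def mult.commute Suc_diff_le)
      qed simp
      finally show ?thesis .
    qed
  qed
  then show ?thesis
    using assms by (simp add: hess_matrix_def v_def)
qed

end
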